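(* Let $f:\mathcal{D}\subset\mathbb{R}^d\to\mathbb{R}^d$ ($\mathcal{D}$ open) and $g:\mathbb{R}^d\to\mathbb{R}^l$ be sufficiently smooth, let $\mathcal{M}=\{y: g(y)=0\}$ be a $(d-l)$-dimensional submanifold of $\mathbb{R}^d$, and suppose that every solution of $\dot y=f(y)$ with $y(0)=y_0\in\mathcal{M}$ satisfies $y(t)\in\mathcal{M}$ for all $t$ (for which it exists). Let $\Phi_h$ be an explicit Runge-Kutta method of order $p$ with time step $h$ for $\dot y=f(y)$. Let $y_n\in\mathcal{M}\cap\mathcal{D}$ be such that $\nabla g(y_n)\in\mathbb{R}^{d\times l}$ has full column rank. Let $y_{n+1}=y_{n+1}(h)$ be the result of one step of size $h$ of the explicit invariants-preserving (EIP) method started at $y_n$, i.e. $$\widehat y_{n+1}=\Phi_h(y_n),\qquad \widehat\lambda=-\left(\nabla g(\widehat y_{n+1})^\top\nabla g(\widehat y_{n+1})\right)^{-1}g(\widehat y_{n+1}),\qquad y_{n+1}=\widehat y_{n+1}+\nabla g(\widehat y_{n+1})\,\widehat\lambda .$$ Then the EIP method has the same order of accuracy as the underlying Runge-Kutta method, that is, if $y(t)$ denotes the exact solution of $\dot y=f(y)$ with $y(t_n)=y_n$ and $t_{n+1}=t_n+h$, then $$y_{n+1}=y(t_{n+1})+\mathcal{O}(h^{p+1})\quad\text{as } h\to 0^+,$$ and the invariant error satisfies $$g(y_{n+1})=\mathcal{O}\big(h^{2(p+1)}\big)\quad\text{as } h\to 0^+ .$$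
   Context: $\nabla g(y)\in\mathbb{R}^{d\times l}$ is the matrix whose $i$-th column is the gradient of the $i$-th component $g_i$ of $g$ at $y$ (the transpose of the Jacobian matrix of $g$). "Sufficiently smooth" means having as many continuous derivatives as needed (it may be read as $C^\infty$). An explicit Runge-Kutta method with $s$ stages and real coefficients $a_{ij}$ ($1\le j<i\le s$), $b_i$ is the map $\Phi_h(y)=y+h\sum_{i=1}^s b_i k_i$, where $k_i=f\big(y+h\sum_{j<i}a_{ij}k_j\big)$. A one-step method has order $p$ if its local error is $\mathcal{O}(h^{p+1})$: for the exact solution $y(t)$ with $y(t_n)=y_n$, one step of size $h$ from $y_n$ yields $y(t_n+h)+\mathcal{O}(h^{p+1})$ as $h\to0^+$. Here $y_n$ is fixed, and the step is considered for all sufficiently small $h>0$ (for which the inverse matrix in the definition of $\widehat\lambda$ exists). *)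

theory Defs
  imports "HOL-Analysis.Analysis" "HOL-Library.Landau_Symbols"
begin

section \<open>Smooth maps and submanifolds\<close>

text \<open>
  In finite dimensions a differentiable map is $C^{k+1}$ on an open set iff all its directional
  derivatives are $C^k$ there. Meaningful for open \<open>S\<close> only.
\<close>

primrec Ck_on ::
  "nat \<Rightarrow> ('a::euclidean_space \<Rightarrow> 'b::euclidean_space) \<Rightarrow> 'a set \<Rightarrow> bool"
where
  "Ck_on 0 f S \<longleftrightarrow> continuous_on S f"
| "Ck_on (Suc k) f S \<longleftrightarrow>
     (\<forall>x\<in>S. f differentiable (at x)) \<and>
     (\<forall>v. Ck_on k (\<lambda>x. frechet_derivative f (at x) v) S)"

definition smooth_on ::
  "('a::euclidean_space \<Rightarrow> 'b::euclidean_space) \<Rightarrow> 'a set \<Rightarrow> bool"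
where
  "smooth_on f S \<longleftrightarrow> (\<forall>k. Ck_on k f S)"

text \<open>
  Embedded \<open>k\<close>-dimensional submanifold of the ambient space: around each of its points there is a
  smooth chart of the ambient space that flattens \<open>M\<close> onto a piece of a \<open>k\<close>-dimensional linear
  subspace.
\<close>

definition submanifold :: "nat \<Rightarrow> 'a::euclidean_space set \<Rightarrow> bool" where
  "submanifold k M \<longleftrightarrow>
     (\<forall>x\<in>M. \<exists>U V \<phi> \<psi> (S :: 'a set).
        open U \<and> x \<in> U \<and> open V \<and> homeomorphism U V \<phi> \<psi> \<and>
        smooth_on \<phi> U \<and> smooth_on \<psi> V \<and>
        subspace S \<and> dim S = k \<and> \<phi> ` (M \<inter> U) = S \<inter> V)"


section \<open>Differential equations and one-step methods\<close>

definition ode_solution ::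
  "('a::euclidean_space \<Rightarrow> 'a) \<Rightarrow> 'a set \<Rightarrow> real set \<Rightarrow> (real \<Rightarrow> 'a) \<Rightarrow> bool"
where
  "ode_solution f D J y \<longleftrightarrow>
     open J \<and> is_interval J \<and>
     (\<forall>t\<in>J. y t \<in> D \<and> (y has_vector_derivative f (y t)) (at t))"

text \<open>
  \<open>\<Phi> h y\<close> is the result of one step of size \<open>h\<close> from \<open>y\<close>. The starting point is fixed as \<open>h\<close>
  tends to 0 from the right.
\<close>

definition local_order_at ::
  "(real \<Rightarrow> 'a \<Rightarrow> 'a) \<Rightarrow> ('a::euclidean_space \<Rightarrow> 'a) \<Rightarrow> 'a set \<Rightarrow> 'a \<Rightarrow> nat \<Rightarrow> bool"
where
  "local_order_at \<Phi> f D y0 p \<longleftrightarrow>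
     (\<forall>J y t0. ode_solution f D J y \<and> t0 \<in> J \<and> y t0 = y0 \<longrightarrow>
        (\<lambda>h. norm (\<Phi> h y0 - y (t0 + h))) \<in> O[at_right 0](\<lambda>h. h ^ (p + 1)))"

text \<open>
  Explicit Runge--Kutta methods; stages are numbered from 1. The field \<open>f\<close> is a total function,
  but for a starting point in its open domain and small \<open>h\<close> all stages are evaluated inside
  the domain.
\<close>

fun rk_stage ::
  "(nat \<Rightarrow> nat \<Rightarrow> real) \<Rightarrow> ('a::euclidean_space \<Rightarrow> 'a) \<Rightarrow> real \<Rightarrow> 'a \<Rightarrow> nat \<Rightarrow> 'a"
where
  "rk_stage a f h y i = f (y + h *\<^sub>R (\<Sum>j\<in>{1..<i}. a i j *\<^sub>R rk_stage a f h y j))"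

declare rk_stage.simps [simp del]

definition rk_step ::
  "nat \<Rightarrow> (nat \<Rightarrow> nat \<Rightarrow> real) \<Rightarrow> (nat \<Rightarrow> real) \<Rightarrow> ('a::euclidean_space \<Rightarrow> 'a) \<Rightarrow>
   real \<Rightarrow> 'a \<Rightarrow> 'a"
where
  "rk_step s a b f h y = y + h *\<^sub>R (\<Sum>i = 1..s. b i *\<^sub>R rk_stage a f h y i)"


section \<open>The explicit invariants-preserving method\<close>

definition grad_matrix :: "(real ^ 'd \<Rightarrow> real ^ 'l) \<Rightarrow> real ^ 'd \<Rightarrow> real ^ 'l ^ 'd" where
  "grad_matrix g y = transpose (jacobian g (at y))"

text \<open>
  \<open>matrix_inv\<close> is unspecified on singular matrices; where the gradient matrix has full column
  rank at the starting point, this does not occur for small \<open>h\<close>.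
\<close>

definition eip_step ::
  "(real ^ 'd \<Rightarrow> real ^ 'l) \<Rightarrow> (real \<Rightarrow> real ^ 'd \<Rightarrow> real ^ 'd) \<Rightarrow>
   real \<Rightarrow> real ^ 'd \<Rightarrow> real ^ 'd"
where
  "eip_step g \<Phi> h y =
     (let yhat = \<Phi> h y;
          G = grad_matrix g yhat;
          lam = - (matrix_inv (transpose G ** G) *v g yhat)
      in yhat + G *v lam)"

end

theory Submission
  imports Defs
begin

text \<open>
  The step of the method moves \<open>x = \<Phi> h yn\<close> by \<open>e = G lam\<close>, where \<open>G = grad_matrix g x\<close> and
  \<open>transpose G ** G\<close> maps \<open>lam\<close> to \<open>- g x\<close>. Near \<open>yn\<close> the matrix \<open>G\<close> is bounded below by
  some \<open>c > 0\<close>, so \<open>norm e \<le> norm (g x) / c\<close>. As \<open>g\<close> vanishes along the exact solution,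
  \<open>g x\<close> is bounded by a multiple of the local error of \<open>\<Phi>\<close>, and hence so is \<open>e\<close>. Since \<open>transpose G\<close>
  is the Jacobian of \<open>g\<close> at \<open>x\<close>, the correction is a Newton step and \<open>g (x + e)\<close> is quadratic
  in \<open>e\<close>. The order hypothesis only speaks about existing solutions, so the bound on the invariant
  error also needs the Picard--Lindelof theorem.
\<close>

section \<open>Lipschitz bounds for smooth maps and their derivatives on balls\<close>

lemma smooth_onD:
  assumes "smooth_on f S"
  shows smooth_on_differentiable: "x \<in> S \<Longrightarrow> f differentiable (at x)"
    and smooth_on_frechet_derivative: "smooth_on (\<lambda>x. frechet_derivative f (at x) v) S"
    and smooth_on_continuous_on: "continuous_on S f"
proof -
  have Ck: "Ck_on k f S" for k
    using assms by (simp add: smooth_on_def)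
  show "x \<in> S \<Longrightarrow> f differentiable (at x)"
    using Ck[of 1] by simp
  show "smooth_on (\<lambda>x. frechet_derivative f (at x) v) S"
    unfolding smooth_on_def using Ck[of "Suc k" for k] by simp
  show "continuous_on S f"
    using Ck[of 0] by simp
qed

lemma smooth_on_has_derivative:
  assumes "smooth_on f S" "x \<in> S"
  shows "(f has_derivative frechet_derivative f (at x)) (at x)"
  using smooth_on_differentiable[OF assms] by (simp add: frechet_derivative_works)

text \<open>Each directional derivative is continuous, hence bounded on the compact ball. The ball
  is convex, so the mean value inequality turns a uniform bound on the derivative into a Lipschitz
  constant.\<close>

lemma smooth_on_lipschitz_cball:
  fixes f :: "'a::euclidean_space \<Rightarrow> 'b::euclidean_space"
  assumes f: "smooth_on f S" and sub: "cball x r \<subseteq> S"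
  obtains L where "L-lipschitz_on (cball x r) f"
proof -
  have "\<exists>B. \<forall>y\<in>cball x r. norm (frechet_derivative f (at y) v) \<le> B" for v
  proof -
    have "continuous_on (cball x r) (\<lambda>y. frechet_derivative f (at y) v)"
      using smooth_on_continuous_on[OF smooth_on_frechet_derivative[OF f]] sub
      by (rule continuous_on_subset)
    then have "bounded ((\<lambda>y. frechet_derivative f (at y) v) ` cball x r)"
      by (intro compact_imp_bounded compact_continuous_image compact_cball)
    then show ?thesis
      by (auto simp: bounded_iff)
  qed
  then obtain B where B: "\<And>v y. y \<in> cball x r \<Longrightarrow> norm (frechet_derivative f (at y) v) \<le> B v"
    by metis
  \<comment> \<open>The operator norm of a linear map is at most the sum of the norms of its values
    on the basis, so finitely many bounds \<open>B v\<close> suffice. The absolute values make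
    \<open>L\<close> nonnegative, as a Lipschitz constant must be.\<close>
  define L where "L = (\<Sum>v\<in>Basis. \<bar>B v\<bar>)"
  have der: "(f has_derivative frechet_derivative f (at y)) (at y)" if "y \<in> cball x r" for y
    using smooth_on_has_derivative[OF f] that sub by blast
  have "onorm (frechet_derivative f (at y)) \<le> L" if "y \<in> cball x r" for y
    unfolding L_def
    by (rule onorm_componentwise_le[OF has_derivative_bounded_linear[OF der[OF that]]])
      (intro sum_mono order_trans[OF B[OF that]], simp)
  then have "norm (f y - f z) \<le> L * norm (y - z)"
    if "y \<in> cball x r" "z \<in> cball x r" for y z
    using that der
    by (intro differentiable_bound[where S = "cball x r"
          and f' = "\<lambda>y. frechet_derivative f (at y)"])
      (auto intro: has_derivative_at_withinI)
  then have "L-lipschitz_on (cball x r) f"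
    by (intro lipschitz_onI) (auto simp: dist_norm L_def intro: sum_nonneg)
  then show ?thesis ..
qed

text \<open>Directional derivatives of a smooth map are again smooth, so
  \<open>smooth_on_lipschitz_cball\<close> applies to each of them; summing their constants over the
  basis controls the operator norm of the difference. This is the source of the quadratic remainder
  of the Newton step.\<close>

lemma smooth_on_frechet_derivative_lipschitz_cball:
  fixes f :: "'a::euclidean_space \<Rightarrow> 'b::euclidean_space"
  assumes f: "smooth_on f S" and sub: "cball x r \<subseteq> S"
  obtains K where "K \<ge> 0"
    "\<And>y z. y \<in> cball x r \<Longrightarrow> z \<in> cball x r \<Longrightarrow>
      onorm (\<lambda>v. frechet_derivative f (at y) v - frechet_derivative f (at z) v) \<le> K * norm (y - z)"
proof -
  have "\<exists>L. L-lipschitz_on (cball x r) (\<lambda>y. frechet_derivative f (at y) v)" for v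
    using smooth_on_lipschitz_cball[OF smooth_on_frechet_derivative[OF f] sub] by metis
  then obtain L where L: "\<And>v. (L v)-lipschitz_on (cball x r) (\<lambda>y. frechet_derivative f (at y) v)"
    by metis
  define K where "K = (\<Sum>v\<in>Basis. L v)"
  have "onorm (\<lambda>v. frechet_derivative f (at y) v - frechet_derivative f (at z) v) \<le> K * norm (y - z)"
    if yz: "y \<in> cball x r" "z \<in> cball x r" for y z
  proof (rule onorm_componentwise_le)
    show "bounded_linear (\<lambda>v. frechet_derivative f (at y) v - frechet_derivative f (at z) v)"
      using yz sub
      by (intro bounded_linear_sub has_derivative_bounded_linear[OF smooth_on_has_derivative[OF f]]) auto
    show "(\<Sum>v\<in>Basis. norm (frechet_derivative f (at y) v - frechet_derivative f (at z) v))
      \<le> K * norm (y - z)"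
      unfolding K_def sum_distrib_right
      using lipschitz_onD[OF L yz] by (intro sum_mono) (simp add: dist_norm)
  qed
  moreover have "K \<ge> 0"
    unfolding K_def by (intro sum_nonneg lipschitz_on_nonneg[OF L])
  ultimately show ?thesis
    using that by blast
qed

section \<open>Local existence of solutions\<close>

text \<open>Picard iteration: the integral form of the equation is a fixed point problem for
  \<open>T\<close> on the complete space of bounded continuous functions, and \<open>T\<close> is a
  contraction for short times.\<close>

lemma lipschitz_imp_local_solution:
  fixes F :: "'a::banach \<Rightarrow> 'a"
  assumes F: "L-lipschitz_on UNIV F"
  obtains u \<delta> where "\<delta> > 0" "u 0 = x0"
    "\<And>t. t \<in> {-\<delta><..<\<delta>} \<Longrightarrow> (u has_vector_derivative F (u t)) (at t)"
proof -
  \<comment> \<open>\<open>T\<close> contains two integrals, each over a range of length at most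
    \<open>2 * \<delta>\<close>, so its Lipschitz constant is at most
    \<open>4 * \<delta> * L\<close>. This choice makes that at most 1/2; the summand 1 covers
    \<open>L = 0\<close>.\<close>
  define \<delta> where "\<delta> = 1 / (8 * (L + 1))"
  have L: "L \<ge> 0"
    using F by (rule lipschitz_on_nonneg)
  then have \<delta>: "\<delta> > 0" "4 * \<delta> * L \<le> 1/2"
    by (auto simp: \<delta>_def field_simps)
  define c where "c t = max (-\<delta>) (min \<delta> t)" for t :: real
  have c_mem: "c t \<in> {-\<delta>..\<delta>}" for t
    using \<delta> by (auto simp: c_def)
  \<comment> \<open>Clamping the time gives bounded functions on the whole line, and the base point \<open>-\<delta>\<close> covers
    both directions of time by integrals with ordered bounds.\<close>
  define T where "T u t = x0 + (integral {-\<delta>..c t} (F \<circ> u) - integral {-\<delta>..0} (F \<circ> u))"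
    for u :: "real \<Rightarrow> 'a" and t
  have cont: "continuous_on A (F \<circ> u)" if "continuous_on UNIV u" for u :: "real \<Rightarrow> 'a" and A
    using lipschitz_on_continuous_on[OF F] that
    by (intro continuous_on_compose) (auto intro: continuous_on_subset)
  have T_bcontfun: "T u \<in> bcontfun" if u: "continuous_on UNIV u" for u
  proof -
    define I where "I r = x0 + (integral {-\<delta>..r} (F \<circ> u) - integral {-\<delta>..0} (F \<circ> u))" for r
    have I: "continuous_on {-\<delta>..\<delta>} I"
      unfolding I_def
      by (intro continuous_intros indefinite_integral_continuous_1 integrable_continuous_real cont[OF u])
    have "continuous_on UNIV c"
      unfolding c_def by (intro continuous_intros)
    then have "continuous_on UNIV (\<lambda>t. I (c t))"
      using c_mem by (intro continuous_on_compose2[OF I]) auto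
    moreover have "bounded (range (\<lambda>t. I (c t)))"
      by (rule bounded_subset[OF compact_imp_bounded[OF compact_continuous_image[OF I]]])
        (use c_mem in auto)
    ultimately show ?thesis
      by (simp add: bcontfun_def T_def I_def)
  qed
  have integral_diff: "norm (integral {-\<delta>..r} (F \<circ> u) - integral {-\<delta>..r} (F \<circ> v)) \<le> 2 * \<delta> * L * dist u v"
    if "r \<in> {-\<delta>..\<delta>}" for u v :: "real \<Rightarrow>\<^sub>C 'a" and r
  proof -
    have "norm (integral {-\<delta>..r} (F \<circ> u) - integral {-\<delta>..r} (F \<circ> v))
      = norm (integral {-\<delta>..r} (\<lambda>t. F (u t) - F (v t)))"
      using cont[of u] cont[of v]
      by (subst integral_diff[symmetric]) (auto intro!: integrable_continuous_real simp: o_def)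
    also have "\<dots> \<le> (L * dist u v) * (r - (-\<delta>))"
    proof (rule integral_bound)
      show "continuous_on {-\<delta>..r} (\<lambda>t. F (u t) - F (v t))"
        using cont[of u] cont[of v] by (auto intro!: continuous_on_diff simp: o_def)
      show "norm (F (u t) - F (v t)) \<le> L * dist u v" for t
        using lipschitz_onD[OF F UNIV_I UNIV_I, of "u t" "v t"] dist_bounded[of u t v] L
        by (simp add: dist_norm) (meson mult_left_mono order_trans)
    qed (use that in auto)
    also have "\<dots> \<le> (L * dist u v) * (2 * \<delta>)"
      using that L by (intro mult_left_mono) auto
    finally show ?thesis
      by (simp add: mult_ac)
  qed
  have "dist (Bcontfun (T u)) (Bcontfun (T v)) \<le> 1/2 * dist u v" for u v :: "real \<Rightarrow>\<^sub>C 'a"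
  proof (rule dist_bound)
    fix t
    have "dist (T u t) (T v t) =
      norm ((integral {-\<delta>..c t} (F \<circ> u) - integral {-\<delta>..c t} (F \<circ> v))
        - (integral {-\<delta>..0} (F \<circ> u) - integral {-\<delta>..0} (F \<circ> v)))"
      by (simp add: T_def dist_norm algebra_simps)
    also have "\<dots> \<le> 2 * \<delta> * L * dist u v + 2 * \<delta> * L * dist u v"
      using c_mem[of t] \<delta>
      by (intro order_trans[OF norm_triangle_ineq4] add_mono integral_diff) auto
    also have "\<dots> = (4 * \<delta> * L) * dist u v"
      by simp
    also have "\<dots> \<le> 1/2 * dist u v"
      using \<delta> by (intro mult_right_mono) auto
    finally show "dist (Bcontfun (T u) t) (Bcontfun (T v) t) \<le> 1/2 * dist u v"
      by (simp add: Bcontfun_inverse T_bcontfun)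
  qed
  then obtain u :: "real \<Rightarrow>\<^sub>C 'a" where "Bcontfun (T u) = u"
    using banach_fix_type[of "1/2" "\<lambda>u. Bcontfun (T (apply_bcontfun u))"] by auto
  \<comment> \<open>Application undoes \<open>Bcontfun\<close> only on functions that are bounded
    and continuous, which is what \<open>T_bcontfun\<close> supplies for \<open>T u\<close>.\<close>
  then have u: "T u = apply_bcontfun u"
    by (metis Bcontfun_inverse T_bcontfun continuous_on_apply_bcontfun)
  show ?thesis
  proof
    show "\<delta> > 0"
      by fact
    show "u 0 = x0"
      using \<delta> by (subst u[symmetric]) (simp add: T_def c_def)
    fix t assume t: "t \<in> {-\<delta><..<\<delta>}"
    have "((\<lambda>r. integral {-\<delta>..r} (F \<circ> u)) has_vector_derivative (F \<circ> u) t) (at t within {-\<delta>..\<delta>})"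
      using t by (intro integral_has_vector_derivative cont) auto
    moreover have "at t within {-\<delta>..\<delta>} = at t"
      using t by (intro at_within_interior) (auto simp: interior_atLeastAtMost_real)
    ultimately have "((\<lambda>r. integral {-\<delta>..r} (F \<circ> u)) has_vector_derivative F (u t)) (at t)"
      by simp
    then have "((\<lambda>r. x0 + (integral {-\<delta>..r} (F \<circ> u) - integral {-\<delta>..0} (F \<circ> u)))
        has_vector_derivative F (u t)) (at t)"
      by (auto intro!: derivative_eq_intros)
    \<comment> \<open>Inside the open interval the clamp \<open>c\<close> is the identity, so there
      the fixed point equation expresses \<open>u\<close> by the unclamped integral.\<close>
    then show "(u has_vector_derivative F (u t)) (at t)"
      by (rule has_vector_derivative_transform_within_open[OF _ open_greaterThanLessThan t])
        (subst u[symmetric], simp add: T_def c_def)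
  qed
qed

text \<open>The globally Lipschitz field obtained from \<open>f\<close> agrees with \<open>f\<close>
  on a ball inside \<open>D\<close>, and by continuity its solution remains in that ball for a short
  time.\<close>

lemma smooth_on_imp_ode_solution:
  fixes f :: "'a::euclidean_space \<Rightarrow> 'a"
  assumes "open D" and f: "smooth_on f D" and "x0 \<in> D"
  obtains J u where "ode_solution f D J u" "0 \<in> J" "u 0 = x0"
proof -
  obtain r where r: "r > 0" "cball x0 r \<subseteq> D"
    using assms open_contains_cball by blast
  obtain L where L: "L-lipschitz_on (cball x0 r) f"
    using smooth_on_lipschitz_cball[OF f r(2)] .
  \<comment> \<open>Composing \<open>f\<close> with the projection onto the ball makes it globally Lipschitz.\<close>
  define P where "P = closest_point (cball x0 r)"
  have "1-lipschitz_on UNIV P"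
    unfolding P_def using r closest_point_lipschitz[of "cball x0 r"] by (intro lipschitz_onI) auto
  moreover have "P ` UNIV \<subseteq> cball x0 r"
    unfolding P_def using r by (intro image_subsetI closest_point_in_set) auto
  ultimately have "(L * 1)-lipschitz_on UNIV (f \<circ> P)"
    by (intro lipschitz_on_compose) (auto intro: lipschitz_on_subset[OF L])
  then obtain u \<delta> where u: "\<delta> > 0" "u 0 = x0"
    "\<And>t. t \<in> {-\<delta><..<\<delta>} \<Longrightarrow> (u has_vector_derivative (f \<circ> P) (u t)) (at t)"
    using lipschitz_imp_local_solution by blast
  have "isCont u 0"
    using u(1) by (intro has_vector_derivative_continuous[OF u(3)]) auto
  then obtain \<epsilon> where \<epsilon>: "\<epsilon> > 0" "\<And>t. dist t 0 < \<epsilon> \<Longrightarrow> dist (u t) x0 < r"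
    unfolding continuous_at_eps_delta using r(1) u(2) by metis
  \<comment> \<open>The bound \<delta> keeps the differential equation valid, the bound \<epsilon>
    keeps \<open>u\<close> in the ball, where the projection \<open>P\<close> does nothing.\<close>
  define J where "J = {- min \<delta> \<epsilon><..<min \<delta> \<epsilon>}"
  have "u t \<in> cball x0 r" if "t \<in> J" for t
  proof -
    have "dist t 0 < \<epsilon>"
      using that by (auto simp: J_def)
    then show ?thesis
      using \<epsilon>(2)[of t] by (simp add: dist_commute)
  qed
  then have "u t \<in> D \<and> (u has_vector_derivative f (u t)) (at t)" if "t \<in> J" for t
    using that r u(3)[of t] by (auto simp: J_def P_def closest_point_self)
  then have "ode_solution f D J u"
    by (auto simp: ode_solution_def J_def is_interval_oo)
  moreover have "0 \<in> J"
    using u \<epsilon> by (simp add: J_def)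
  ultimately show ?thesis
    using u that by blast
qed

section \<open>Transposes and Gram matrices\<close>

text \<open>Pair \<open>w = transpose A *v v\<close> with itself, move the transpose to the other
  side, apply Cauchy-Schwarz and cancel one factor \<open>norm w\<close>. It carries bounds on the
  Jacobian over to the gradient matrix.\<close>

lemma norm_transpose_vector_mult_le:
  fixes A :: "real ^ 'n ^ 'm"
  shows "norm (transpose A *v v) \<le> onorm ((*v) A) * norm v"
proof -
  define w where "w = transpose A *v v"
  have "w \<bullet> w = v \<bullet> (A *v w)"
    by (simp add: w_def dot_lmul_matrix)
  also have "\<dots> \<le> norm v * (onorm ((*v) A) * norm w)"
    by (intro order_trans[OF norm_cauchy_schwarz] mult_left_mono onorm) auto
  finally have "norm w * norm w \<le> (onorm ((*v) A) * norm v) * norm w"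
    by (simp add: dot_square_norm power2_eq_square mult_ac)
  then show ?thesis
    unfolding w_def[symmetric]
    by (cases "w = 0") (auto simp: onorm_pos_le)
qed

lemma matrix_inv_mult:
  assumes "invertible A"
  shows "A ** matrix_inv A = mat 1"
  using someI_ex[OF assms[unfolded invertible_def]] by (simp add: matrix_inv_def)

text \<open>The lower bound makes \<open>A\<close> injective, so the Gram matrix has trivial kernel
  and is invertible. For the size of \<open>e = A *v lam\<close>, the identity
  \<open>e \<bullet> e = w \<bullet> lam\<close> and \<open>norm lam \<le> norm e / c\<close> allow
  one factor \<open>norm e\<close> to be cancelled. In the method \<open>A\<close> is the gradient
  matrix and \<open>w = - g x\<close>.\<close>

lemma gram_matrix_inv_solution:
  fixes A :: "real ^ 'l ^ 'd" and w :: "real ^ 'l"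
  assumes "c > 0" and below: "\<And>v. c * norm v \<le> norm (A *v v)"
  defines "e \<equiv> A *v (matrix_inv (transpose A ** A) *v w)"
  shows "transpose A *v e = w" and "norm e \<le> norm w / c"
proof -
  define lam where "lam = matrix_inv (transpose A ** A) *v w"
  have "v = 0" if "(transpose A ** A) *v v = 0" for v
  proof -
    have "(A *v v) \<bullet> (A *v v) = (transpose A *v (A *v v)) \<bullet> v"
      by (simp add: dot_lmul_matrix)
    also have "\<dots> = 0"
      using that by (simp only: matrix_vector_mul_assoc inner_zero_left)
    finally show ?thesis
      using below[of v] \<open>c > 0\<close> by (simp add: mult_le_0_iff)
  qed
  then have "invertible (transpose A ** A)"
    unfolding invertible_left_inverse matrix_left_invertible_ker by blast
  then have "(transpose A ** A) *v lam = w"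
    unfolding lam_def matrix_vector_mul_assoc by (simp only: matrix_inv_mult matrix_vector_mul_lid)
  then show solves: "transpose A *v e = w"
    by (simp only: e_def lam_def matrix_vector_mul_assoc matrix_mul_assoc)
  have "norm e * norm e = e \<bullet> (A *v lam)"
    by (simp add: e_def lam_def dot_square_norm power2_eq_square)
  also have "\<dots> = w \<bullet> lam"
    using solves by (simp flip: dot_lmul_matrix)
  also have "\<dots> \<le> norm w * norm lam"
    by (rule norm_cauchy_schwarz)
  also have "\<dots> \<le> norm w * (norm e / c)"
    using below[of lam] \<open>c > 0\<close>
    by (intro mult_left_mono) (auto simp: e_def lam_def field_simps)
  finally have "norm e * norm e \<le> (norm w / c) * norm e"
    by simp
  then show "norm e \<le> norm w / c"
    using \<open>c > 0\<close> by (cases "e = 0") (auto simp del: times_divide_eq_left)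
qed

section \<open>Uniform estimate for one corrected step\<close>

lemma smooth_on_jacobian:
  fixes g :: "real ^ 'd \<Rightarrow> real ^ 'l"
  assumes "smooth_on g S" "y \<in> S"
  shows "frechet_derivative g (at y) = (*v) (jacobian g (at y))"
  using smooth_on_differentiable[OF assms]
  unfolding jacobian_works by (rule frechet_derivative_at[symmetric])

text \<open>The constants depend on \<open>g\<close> and \<open>y0\<close> only, so they serve all
  small step sizes at once. The zero \<open>z\<close> of \<open>g\<close> is later a point of the
  exact solution, and \<open>norm (\<Phi> h y - z)\<close> is then the local error.\<close>

lemma eip_step_estimate:
  fixes g :: "real ^ 'd \<Rightarrow> real ^ 'l" and y0 :: "real ^ 'd"
  assumes g: "smooth_on g UNIV" and rank: "rank (grad_matrix g y0) = CARD('l)"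
  obtains r C where "r > 0" "C \<ge> 0"
    "\<And>\<Phi> h y z. \<lbrakk>\<Phi> h y \<in> cball y0 r; z \<in> cball y0 r; g z = 0\<rbrakk> \<Longrightarrow>
      norm (eip_step g \<Phi> h y - z) \<le> C * norm (\<Phi> h y - z) \<and>
      norm (g (eip_step g \<Phi> h y)) \<le> C * (norm (\<Phi> h y - z))\<^sup>2"
proof -
  define J where "J y = jacobian g (at y)" for y
  have G: "grad_matrix g y = transpose (J y)" for y
    by (simp add: grad_matrix_def J_def)
  have J: "frechet_derivative g (at y) = (*v) (J y)" for y
    unfolding J_def using g by (rule smooth_on_jacobian) simp
  obtain L where L: "L-lipschitz_on (cball y0 1) g"
    using smooth_on_lipschitz_cball[OF g subset_UNIV] .
  have L0: "L \<ge> 0"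
    using L by (rule lipschitz_on_nonneg)
  obtain K where K0: "K \<ge> 0" and K: "\<And>y z. y \<in> cball y0 1 \<Longrightarrow> z \<in> cball y0 1 \<Longrightarrow>
      onorm (\<lambda>v. J y *v v - J z *v v) \<le> K * norm (y - z)"
    by (rule smooth_on_frechet_derivative_lipschitz_cball[OF g subset_UNIV[of "cball y0 1"], unfolded J])
      (rule that)
  \<comment> \<open>Full column rank means injectivity, and an injective linear map in finite
    dimension is bounded below.\<close>
  obtain c0 where "c0 > 0" and c0: "\<And>v. c0 * norm v \<le> norm (grad_matrix g y0 *v v)"
    using rank linear_inj_bounded_below_pos[of "(*v) (grad_matrix g y0)"]
    unfolding full_rank_injective by (metis matrix_vector_mul_linear mult.commute)
  \<comment> \<open>One half of \<open>c0\<close> is given up to the variation of the gradient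
    matrix over the ball of radius \<open>r\<close>.\<close>
  define c where "c = c0 / 2"
  have c: "c > 0"
    using \<open>c0 > 0\<close> by (simp add: c_def)
  \<comment> \<open>The three bounds keep the points in the unit ball, where \<open>L\<close> and
    \<open>K\<close> are valid, give \<open>K * r \<le> c\<close> for the lower bound on the
    gradient matrix, and keep the corrected point in the unit ball as well.\<close>
  define r where "r = min (min 1 (c / (K + 1))) (1 / (1 + 2 * L / c))"
  have "1 + 2 * L / c > 0"
    using L0 c by (intro add_pos_nonneg) auto
  then have r: "r > 0" "r \<le> 1" "K * r \<le> c" "r + L / c * (2 * r) \<le> 1"
  proof -
    show "r > 0" "r \<le> 1"
      using K0 c \<open>1 + 2 * L / c > 0\<close> by (auto simp: r_def)
    have "r \<le> c / (K + 1)"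
      by (simp add: r_def)
    then have "r * (K + 1) \<le> c"
      using K0 by (subst (asm) pos_le_divide_eq) auto
    then show "K * r \<le> c"
      using \<open>r > 0\<close> by (simp add: algebra_simps)
    have "r \<le> 1 / (1 + 2 * L / c)"
      by (simp add: r_def)
    then have "r * (1 + 2 * L / c) \<le> 1"
      using \<open>1 + 2 * L / c > 0\<close> by (subst (asm) pos_le_divide_eq) auto
    then show "r + L / c * (2 * r) \<le> 1"
      by (simp add: algebra_simps)
  qed
  have below: "c * norm v \<le> norm (grad_matrix g x *v v)" if "x \<in> cball y0 r" for x v
  proof -
    have "norm (grad_matrix g y0 *v v - grad_matrix g x *v v) = norm (transpose (J y0 - J x) *v v)"
    proof -
      have "transpose (J y0 - J x) = transpose (J y0) - transpose (J x)"
        by (simp add: transpose_def vec_eq_iff)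
      then show ?thesis
        by (simp only: G matrix_vector_mult_diff_rdistrib)
    qed
    also have "\<dots> \<le> onorm ((*v) (J y0 - J x)) * norm v"
      by (rule norm_transpose_vector_mult_le)
    also have "onorm ((*v) (J y0 - J x)) \<le> K * norm (y0 - x)"
      using K[of y0 x] that r by (simp flip: matrix_vector_mult_diff_rdistrib)
    also have "K * norm (y0 - x) \<le> K * r"
      using that K0 by (intro mult_left_mono) (auto simp: dist_norm)
    also have "K * r \<le> c"
      by fact
    finally have "norm (grad_matrix g y0 *v v - grad_matrix g x *v v) \<le> c * norm v"
      by (simp add: mult_right_mono)
    with norm_triangle_ineq2[of "grad_matrix g y0 *v v" "grad_matrix g x *v v"] c0[of v]
    show ?thesis
      by (simp add: c_def)
  qed
  have correction: "norm (eip_step g \<Phi> h y - z) \<le> (1 + L / c) * norm (\<Phi> h y - z) \<and>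
      norm (g (eip_step g \<Phi> h y)) \<le> K * (L / c)\<^sup>2 * (norm (\<Phi> h y - z))\<^sup>2"
    if x: "\<Phi> h y \<in> cball y0 r" and z: "z \<in> cball y0 r" "g z = 0" for \<Phi> h y z
  proof -
    define x where "x = \<Phi> h y"
    define e where "e = eip_step g \<Phi> h y - x"
    have step: "eip_step g \<Phi> h y = x + e"
      by (simp add: e_def)
    have e: "e = grad_matrix g x *v (matrix_inv (transpose (grad_matrix g x) ** grad_matrix g x) *v (- g x))"
      by (simp add: e_def eip_step_def Let_def x_def linear_neg[OF matrix_vector_mul_linear])
    note gram = gram_matrix_inv_solution[OF c below[OF x, folded x_def], of "- g x", folded e]
    have Je: "J x *v e = - g x"
      using gram(1) by (simp add: G transpose_transpose del: transpose_matrix_vector)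
    have x1: "x \<in> cball y0 1" and z1: "z \<in> cball y0 1"
      using x z r(2) by (auto simp: x_def)
    have "norm (g x) \<le> L * norm (x - z)"
      using lipschitz_onD[OF L x1 z1] z(2) by (simp add: dist_norm)
    then have "norm (g x) / c \<le> L * norm (x - z) / c"
      using c by (intro divide_right_mono) auto
    with gram(2) have e_le: "norm e \<le> L / c * norm (x - z)"
      by simp
    \<comment> \<open>The correction is at most \<open>L / c * (2 * r)\<close>, so the last
      condition on \<open>r\<close> puts \<open>x + e\<close>, and by convexity the whole segment
      from \<open>x\<close>, into the unit ball, where the derivative bound \<open>K\<close>
      holds.\<close>
    have "dist x z \<le> 2 * r"
      using x z dist_triangle3[of x z y0] by (simp add: x_def)
    then have "L / c * norm (x - z) \<le> L / c * (2 * r)"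
      using L0 c by (intro mult_left_mono) (auto simp: dist_norm)
    then have "dist y0 (x + e) \<le> r + L / c * (2 * r)"
      using e_le dist_triangle[of y0 "x + e" x] x by (simp add: x_def dist_norm)
    then have xe1: "x + e \<in> cball y0 1"
      using r(4) by simp
    have seg: "closed_segment x (x + e) \<subseteq> cball y0 1"
      using x1 xe1 by (intro closed_segment_subset convex_cball)
    \<comment> \<open>By \<open>Je\<close> the term \<open>J x *v e\<close> cancels
      \<open>g x\<close>, so the left side is just \<open>norm (g (x + e))\<close>, while the
      derivative varies by at most \<open>K * norm e\<close> along the segment.\<close>
    have "norm (g (x + e) - g x - J x *v (x + e - x)) \<le> norm (x + e - x) * (K * norm e)"
    proof (rule differentiable_bound_linearization[where S = "closed_segment x (x + e)"
          and f = g and f' = "\<lambda>u v. J u *v v" and a = x and b = "x + e" and ?x0.0 = x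
          and B = "K * norm e"])
      show "x + t *\<^sub>R (x + e - x) \<in> closed_segment x (x + e)" if "t \<in> {0..1}" for t
        using that unfolding in_segment by (intro exI[of _ t]) (simp add: algebra_simps)
      show "(g has_derivative (\<lambda>v. J u *v v)) (at u within closed_segment x (x + e))" for u
        by (rule has_derivative_at_withinI) (rule smooth_on_has_derivative[OF g UNIV_I, unfolded J])
      show "onorm ((\<lambda>v. J u *v v) - (\<lambda>v. J x *v v)) \<le> K * norm e"
        if "u \<in> closed_segment x (x + e)" for u
      proof -
        have "onorm ((\<lambda>v. J u *v v) - (\<lambda>v. J x *v v)) \<le> K * norm (u - x)"
          using K[of u x] that seg x1 by (auto simp: fun_diff_def)
        also have "\<dots> \<le> K * norm e"
          using segment_bound1[OF that] K0 by (intro mult_left_mono) auto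
        finally show ?thesis .
      qed
    qed auto
    then have "norm (g (x + e)) \<le> K * (norm e)\<^sup>2"
      by (simp add: Je power2_eq_square mult_ac)
    also have "\<dots> \<le> K * (L / c * norm (x - z))\<^sup>2"
      using e_le K0 by (intro mult_left_mono power_mono) auto
    finally have "norm (g (x + e)) \<le> K * (L / c)\<^sup>2 * (norm (x - z))\<^sup>2"
      by (simp only: power_mult_distrib mult.assoc)
    moreover have "norm (x + e - z) \<le> (1 + L / c) * norm (x - z)"
      using norm_triangle_ineq[of "x - z" e] e_le by (simp add: algebra_simps)
    ultimately show ?thesis
      by (simp add: step x_def)
  qed
  define C where "C = max (1 + L / c) (K * (L / c)\<^sup>2)"
  show ?thesis
  proof
    show "C \<ge> 0"
      unfolding C_def by (intro max.coboundedI2 mult_nonneg_nonneg K0 zero_le_power2)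
    show "norm (eip_step g \<Phi> h y - z) \<le> C * norm (\<Phi> h y - z) \<and>
      norm (g (eip_step g \<Phi> h y)) \<le> C * (norm (\<Phi> h y - z))\<^sup>2"
      if "\<Phi> h y \<in> cball y0 r" "z \<in> cball y0 r" "g z = 0" for \<Phi> h y z
    proof -
      have "(1 + L / c) * norm (\<Phi> h y - z) \<le> C * norm (\<Phi> h y - z)"
        "K * (L / c)\<^sup>2 * (norm (\<Phi> h y - z))\<^sup>2 \<le> C * (norm (\<Phi> h y - z))\<^sup>2"
        by (auto simp: C_def intro!: mult_right_mono)
      then show ?thesis
        using correction[of \<Phi> h y z] that by linarith
    qed
  qed (rule r)
qed

section \<open>Error orders along exact solutions\<close>

text \<open>The field is autonomous, so time may be translated. This brings a solution through
  \<open>yn\<close> at time \<open>t0\<close> to starting time 0, the one for which invariance of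
  \<open>M\<close> is assumed.\<close>

lemma ode_solution_shift:
  assumes "ode_solution f D J y"
  shows "ode_solution f D ((\<lambda>t. t - t0) ` J) (\<lambda>t. y (t + t0))"
proof -
  have J: "open J" "is_interval J"
    and y: "\<And>t. t \<in> J \<Longrightarrow> y t \<in> D \<and> (y has_vector_derivative f (y t)) (at t)"
    using assms by (auto simp: ode_solution_def)
  have "((\<lambda>t. y (t + t0)) has_vector_derivative f (y t)) (at (t - t0))" if "t \<in> J" for t
  proof -
    have "((\<lambda>t. t + t0) has_vector_derivative 1) (at (t - t0))"
      by (auto intro!: derivative_eq_intros)
    from vector_diff_chain_at[OF this, of y "f (y t)"] y[OF that] show ?thesis
      by (simp add: o_def)
  qed
  then show ?thesis
    using J y open_translation_subtract[of J t0] by (auto simp: ode_solution_def)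
qed

text \<open>For small \<open>h\<close> the point \<open>y (t0 + h)\<close> is a zero of
  \<open>g\<close> near \<open>yn\<close>, so it can be the \<open>z\<close> of
  \<open>eip_step_estimate\<close>. The two conclusions are its linear and quadratic bounds, with
  the local error of \<Phi> inserted.\<close>

lemma eip_step_local_error:
  fixes g :: "real ^ 'd \<Rightarrow> real ^ 'l"
  assumes g: "smooth_on g UNIV" and rank: "rank (grad_matrix g yn) = CARD('l)"
    and sol: "ode_solution f D J y" "t0 \<in> J" "y t0 = yn"
    and inv: "\<And>t. t \<in> J \<Longrightarrow> g (y t) = 0"
    and order: "local_order_at \<Phi> f D yn p"
  shows "(\<lambda>h. norm (eip_step g \<Phi> h yn - y (t0 + h))) \<in> O[at_right 0](\<lambda>h. h ^ (p + 1))"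
    and "(\<lambda>h. norm (g (eip_step g \<Phi> h yn))) \<in> O[at_right 0](\<lambda>h. h ^ (2 * (p + 1)))"
proof -
  define err where "err h = norm (\<Phi> h yn - y (t0 + h))" for h
  have err: "err \<in> O[at_right 0](\<lambda>h. h ^ (p + 1))"
    using order sol unfolding local_order_at_def err_def by blast
  obtain r C where r: "r > 0" and C: "C \<ge> 0"
    and est: "\<And>\<Phi> h y z. \<lbrakk>\<Phi> h y \<in> cball yn r; z \<in> cball yn r; g z = 0\<rbrakk> \<Longrightarrow>
      norm (eip_step g \<Phi> h y - z) \<le> C * norm (\<Phi> h y - z) \<and>
      norm (g (eip_step g \<Phi> h y)) \<le> C * (norm (\<Phi> h y - z))\<^sup>2"
    using eip_step_estimate[OF g rank] by metis
  have t0: "((\<lambda>h. t0 + h) \<longlongrightarrow> t0) (at_right 0)"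
    by (auto intro!: tendsto_eq_intros)
  have "isCont y t0"
    using sol by (intro has_vector_derivative_continuous) (auto simp: ode_solution_def)
  from isCont_tendsto_compose[OF this t0]
  have y_lim: "((\<lambda>h. y (t0 + h)) \<longlongrightarrow> yn) (at_right 0)"
    using sol by simp
  obtain K where "eventually (\<lambda>h. norm (err h) \<le> K * norm (h ^ (p + 1))) (at_right 0)"
    using err by (elim landau_o.bigE)
  \<comment> \<open>The exponent \<open>p + 1\<close> is positive even for \<open>p = 0\<close>, so
    the limit on the right is 0 and the local error tends to 0.\<close>
  moreover have "((\<lambda>h::real. K * norm (h ^ (p + 1))) \<longlongrightarrow> K * norm ((0::real) ^ (p + 1))) (at_right 0)"
    by (intro tendsto_mult_left tendsto_norm tendsto_power tendsto_ident_at)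
  ultimately have "(err \<longlongrightarrow> 0) (at_right 0)"
    by (intro Lim_null_comparison[where f = err]) simp_all
  \<comment> \<open>Half of \<open>r\<close> goes to the local error and half to the motion of the
    exact solution, which together keep \<open>\<Phi> h yn\<close> within \<open>r\<close> of
    \<open>yn\<close>.\<close>
  then have "eventually (\<lambda>h. err h < r / 2) (at_right 0)"
    using r by (intro order_tendstoD) auto
  moreover have "eventually (\<lambda>h. dist (y (t0 + h)) yn < r / 2) (at_right 0)"
    using r by (intro tendstoD[OF y_lim]) simp
  moreover have "eventually (\<lambda>h. t0 + h \<in> J) (at_right 0)"
    using topological_tendstoD[OF t0] sol by (auto simp: ode_solution_def)
  ultimately have ev: "eventually (\<lambda>h. norm (eip_step g \<Phi> h yn - y (t0 + h)) \<le> C * err h \<and>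
      norm (g (eip_step g \<Phi> h yn)) \<le> C * (err h)\<^sup>2) (at_right 0)"
  proof eventually_elim
    case (elim h)
    have "dist (\<Phi> h yn) yn \<le> r"
      using elim dist_triangle[of "\<Phi> h yn" yn "y (t0 + h)"] by (simp add: err_def dist_norm)
    then show ?case
      unfolding err_def using elim inv r by (intro est) (auto simp: dist_commute)
  qed
  have "(\<lambda>h. norm (eip_step g \<Phi> h yn - y (t0 + h))) \<in> O[at_right 0](err)"
    using ev by (intro bigoI[of _ C]) (auto elim!: eventually_mono simp: err_def)
  then show "(\<lambda>h. norm (eip_step g \<Phi> h yn - y (t0 + h))) \<in> O[at_right 0](\<lambda>h. h ^ (p + 1))"
    using err by (rule landau_o.big_trans)
  have "(\<lambda>h. norm (g (eip_step g \<Phi> h yn))) \<in> O[at_right 0](\<lambda>h. (err h)\<^sup>2)"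
    using ev by (intro bigoI[of _ C]) (auto elim!: eventually_mono)
  also have "(\<lambda>h. (err h)\<^sup>2) \<in> O[at_right 0](\<lambda>h. (h ^ (p + 1))\<^sup>2)"
    using err by (rule landau_o.big_power)
  finally show "(\<lambda>h. norm (g (eip_step g \<Phi> h yn))) \<in> O[at_right 0](\<lambda>h. h ^ (2 * (p + 1)))"
    by (simp only: power_mult[symmetric] mult.commute[of "p + 1"])
qed

theorem theorem2p1:
  fixes D :: "(real ^ 'd) set"
    and f :: "real ^ 'd \<Rightarrow> real ^ 'd"
    and g :: "real ^ 'd \<Rightarrow> real ^ 'l"
    and M :: "(real ^ 'd) set"
    and s p :: nat
    and a :: "nat \<Rightarrow> nat \<Rightarrow> real"
    and b :: "nat \<Rightarrow> real"
    and yn :: "real ^ 'd"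
  assumes "open D"
    and "smooth_on f D"
    and "smooth_on g UNIV"
    and "M = {y. g y = 0}"
    and "CARD('l) \<le> CARD('d)"
    and "submanifold (CARD('d) - CARD('l)) M"
    and "\<And>J y. ode_solution f D J y \<Longrightarrow> 0 \<in> J \<Longrightarrow> y 0 \<in> M \<Longrightarrow> \<forall>t\<in>J. y t \<in> M"
    and "\<And>y0. y0 \<in> D \<Longrightarrow> local_order_at (rk_step s a b f) f D y0 p"
    and "yn \<in> M \<inter> D"
    and "rank (grad_matrix g yn) = CARD('l)"
  shows "local_order_at (eip_step g (rk_step s a b f)) f D yn p \<and>
    (\<lambda>h. norm (g (eip_step g (rk_step s a b f) h yn))) \<in> O[at_right 0](\<lambda>h. h ^ (2 * (p + 1)))"
proof -
  note D = \<open>open D\<close> and f = \<open>smooth_on f D\<close> and g = \<open>smooth_on g UNIV\<close>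
    and rank = \<open>rank (grad_matrix g yn) = CARD('l)\<close>
  have yn: "yn \<in> M" "yn \<in> D"
    using \<open>yn \<in> M \<inter> D\<close> by auto
  have order: "local_order_at (rk_step s a b f) f D yn p"
    using assms(8) yn by blast
  have inv: "g (y t) = 0" if "ode_solution f D J y" "t0 \<in> J" "y t0 = yn" "t \<in> J" for J y t0 t
    using assms(7)[OF ode_solution_shift[OF that(1), of t0]] that yn \<open>M = {y. g y = 0}\<close>
    by (auto simp: image_iff)
  note error = eip_step_local_error[OF g rank _ _ _ _ order]
  obtain J u where "ode_solution f D J u" "0 \<in> J" "u 0 = yn"
    using smooth_on_imp_ode_solution[OF D f yn(2)] .
  then have "(\<lambda>h. norm (g (eip_step g (rk_step s a b f) h yn))) \<in> O[at_right 0](\<lambda>h. h ^ (2 * (p + 1)))"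
    using error(2) inv by blast
  moreover have "local_order_at (eip_step g (rk_step s a b f)) f D yn p"
    unfolding local_order_at_def using error(1) inv by blast
  ultimately show ?thesis
    by blast
qed

end
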